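(* There exists, for each dimension $d$, a family $\mathcal{S}$ of subsets of $\mathbb{R}^d$ with Gaussian surface area $\Gamma(\mathcal{S})=O(d)$ such that any algorithm that draws $m$ independent samples from a truncated Gaussian $\mathcal{N}(\boldsymbol\mu,\boldsymbol I,S)$, with unknown $\boldsymbol\mu\in\mathbb{R}^d$ and unknown $S\in\mathcal{S}$, and computes (with probability at least $99\%$) an estimate $\widetilde{\boldsymbol\mu}$ with $\|\widetilde{\boldsymbol\mu}-\boldsymbol\mu\|_2\le1$ must have $m=\Omega(2^{d/2})$.
   Context: $\mathcal{N}(\boldsymbol\mu,\boldsymbol I,S)$ is the Gaussian with mean $\boldsymbol\mu$ and identity covariance conditioned on lying in $S$. Gaussian surface area: for a Borel set $A\subseteq\mathbb{R}^d$ let $A_\delta=\{x:\mathrm{dist}(x,A)\le\delta\}$ and $\Gamma(A)=\liminf_{\delta\to0}\mathcal{N}_0(A_\delta\setminus A)/\delta$, where $\mathcal{N}_0$ is the standard Gaussian measure on $\mathbb{R}^d$; for a family, $\Gamma(\mathcal{S})=\sup_{A\in\mathcal{S}}\Gamma(A)$. The constants in $O(\cdot)$ and $\Omega(\cdot)$ are absolute. *)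

theory Defs
  imports "HOL-Probability.Probability"
begin

text \<open>
  The dimension has to be quantified inside the statement, because the constants must not
  depend on it. Points of \<open>\<real>\<^sup>d\<close> are therefore the extensional functions on \<open>{..<d}\<close>; for finitely
  many coordinates the product sigma-algebra is the Borel sigma-algebra of \<open>\<real>\<^sup>d\<close>.
\<close>

definition Rd :: "nat \<Rightarrow> (nat \<Rightarrow> real) measure" where
  "Rd d = PiM {..<d} (\<lambda>_. borel)"

definition eucl_dist :: "nat \<Rightarrow> (nat \<Rightarrow> real) \<Rightarrow> (nat \<Rightarrow> real) \<Rightarrow> real" where
  "eucl_dist d x y = L2_set (\<lambda>i. x i - y i) {..<d}"

text \<open>Identity covariance means independent coordinates of unit variance.\<close>

definition gaussian :: "nat \<Rightarrow> (nat \<Rightarrow> real) \<Rightarrow> (nat \<Rightarrow> real) measure" where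
  "gaussian d \<mu> = PiM {..<d} (\<lambda>i. density lborel (normal_density (\<mu> i) 1))"

abbreviation std_gaussian :: "nat \<Rightarrow> (nat \<Rightarrow> real) measure" where
  "std_gaussian d \<equiv> gaussian d (\<lambda>i\<in>{..<d}. 0)"

text \<open>
  Conditioning on \<open>S\<close> requires \<open>S\<close> to be Borel and of positive mass. All Gaussians with identity
  covariance have the same null sets, so the condition does not depend on the mean.
\<close>

definition truncated_gaussian ::
    "nat \<Rightarrow> (nat \<Rightarrow> real) \<Rightarrow> (nat \<Rightarrow> real) set \<Rightarrow> (nat \<Rightarrow> real) measure" where
  "truncated_gaussian d \<mu> S = uniform_measure (gaussian d \<mu>) S"

definition truncation_sets :: "nat \<Rightarrow> (nat \<Rightarrow> real) set set" where
  "truncation_sets d = {S \<in> sets (Rd d). emeasure (std_gaussian d) S > 0}"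

text \<open>The infimum is taken in \<open>[0, \<infinity>]\<close>, so that the distance to the empty set is infinite.\<close>

definition dist_to_set :: "nat \<Rightarrow> (nat \<Rightarrow> real) \<Rightarrow> (nat \<Rightarrow> real) set \<Rightarrow> ennreal" where
  "dist_to_set d x A = (INF a\<in>A. ennreal (eucl_dist d x a))"

definition enlargement :: "nat \<Rightarrow> (nat \<Rightarrow> real) set \<Rightarrow> real \<Rightarrow> (nat \<Rightarrow> real) set" where
  "enlargement d A \<delta> = {x \<in> space (Rd d). dist_to_set d x A \<le> ennreal \<delta>}"

definition gaussian_surface_area :: "nat \<Rightarrow> (nat \<Rightarrow> real) set \<Rightarrow> ennreal" where
  "gaussian_surface_area d A =
     Liminf (at_right 0) (\<lambda>\<delta>. emeasure (std_gaussian d) (enlargement d A \<delta> - A) / ennreal \<delta>)"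

definition family_surface_area :: "nat \<Rightarrow> (nat \<Rightarrow> real) set set \<Rightarrow> ennreal" where
  "family_surface_area d \<S> = (SUP A\<in>\<S>. gaussian_surface_area d A)"

text \<open>
  An algorithm may be randomized: it is a Markov kernel sending the \<open>m\<close> samples to the
  distribution of its output. Deterministic algorithms are the kernels into point masses.
\<close>

definition algorithms :: "nat \<Rightarrow> nat \<Rightarrow> ((nat \<Rightarrow> nat \<Rightarrow> real) \<Rightarrow> (nat \<Rightarrow> real) measure) set" where
  "algorithms d m = measurable (PiM {..<m} (\<lambda>_. Rd d)) (prob_algebra (Rd d))"

definition output_distribution ::
    "nat \<Rightarrow> nat \<Rightarrow> ((nat \<Rightarrow> nat \<Rightarrow> real) \<Rightarrow> (nat \<Rightarrow> real) measure)
      \<Rightarrow> (nat \<Rightarrow> real) \<Rightarrow> (nat \<Rightarrow> real) set \<Rightarrow> (nat \<Rightarrow> real) measure" where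
  "output_distribution d m K \<mu> S = bind (PiM {..<m} (\<lambda>_. truncated_gaussian d \<mu> S)) K"

definition estimates_mean ::
    "nat \<Rightarrow> (nat \<Rightarrow> real) set set \<Rightarrow> nat
      \<Rightarrow> ((nat \<Rightarrow> nat \<Rightarrow> real) \<Rightarrow> (nat \<Rightarrow> real) measure) \<Rightarrow> bool" where
  "estimates_mean d \<S> m K \<longleftrightarrow>
     (\<forall>\<mu>\<in>space (Rd d). \<forall>S\<in>\<S>.
        measure (output_distribution d m K \<mu> S) {y \<in> space (Rd d). eucl_dist d y \<mu> \<le> 1} \<ge> 99 / 100)"

end

theory Submission
  imports Defs
begin

text \<open>
  The sign pattern of the coordinates \<open>1, \<dots>, d - 1\<close> cuts space into \<open>2\<^sup>d\<^sup>-\<^sup>1\<close> cells of equal mass.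
  In each cell the truncation set is a half space \<open>s * x\<^sub>0 \<le> t\<close>, where \<open>s\<close> is \<open>1\<close> or \<open>-1\<close>, the
  threshold \<open>t \<ge> 0\<close> depends on the cell and the mean is \<open>2 s e\<^sub>0\<close>. All faces lie on \<open>d - 1\<close>
  hyperplanes and on one hyperplane piece per cell, so the surface area is \<open>O(d)\<close>. For independent
  exponential thresholds of rate \<open>4\<close>, a point survives with probability
  \<open>min 1 (exp (- 4 s x\<^sub>0))\<close>, and the two Gaussian densities times this probability are the same
  function, the minimum of both. Hence, as long as no two samples share a cell, averaging over the
  thresholds makes the two values of \<open>s\<close> indistinguishable, and by the birthday bound a collision
  requires order \<open>2\<^sup>d\<^sup>/\<^sup>2\<close> samples. The normalizing constant \<open>Z\<^sup>m\<close> of the truncated samples depends on the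
  thresholds; the argument therefore compares unnormalized integrals, and only a lower bound for
  \<open>Z\<close> enters, in the collision probability.
\<close>

section \<open>Products of densities\<close>

text \<open>Both measures agree on boxes, because the indicator of a box is a product and Tonelli
  factors the integral; boxes determine a product of sigma-finite measures. The same identity later
  handles the truncation of single samples and the averaging over thresholds.\<close>

lemma PiM_density:
  fixes M :: "'i \<Rightarrow> 'a measure"
  assumes I: "finite I"
    and M: "\<And>i. sigma_finite_measure (M i)"
    and f [measurable]: "\<And>i. f i \<in> borel_measurable (M i)"
    and D: "\<And>i. sigma_finite_measure (density (M i) (f i))"
  shows "PiM I (\<lambda>i. density (M i) (f i)) = density (PiM I M) (\<lambda>x. \<Prod>i\<in>I. f i (x i))"
proof -
  interpret M: product_sigma_finite M
    using M by (simp add: product_sigma_finite_def)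
  interpret D: product_sigma_finite "\<lambda>i. density (M i) (f i)"
    using D by (simp add: product_sigma_finite_def)
  show ?thesis
  proof (rule D.PiM_eqI[symmetric])
    fix A assume "\<And>i. i \<in> I \<Longrightarrow> A i \<in> sets (density (M i) (f i))"
    then have A [measurable]: "\<And>i. i \<in> I \<Longrightarrow> A i \<in> sets (M i)" by simp
    have ind: "indicator (Pi\<^sub>E I A) x = (\<Prod>i\<in>I. indicator (A i) (x i) :: ennreal)"
      if "x \<in> space (PiM I M)" for x
      using that I by (auto simp: indicator_def PiE_iff space_PiM prod_zero_iff)
    have "emeasure (density (PiM I M) (\<lambda>x. \<Prod>i\<in>I. f i (x i))) (Pi\<^sub>E I A)
        = (\<integral>\<^sup>+x. (\<Prod>i\<in>I. f i (x i)) * indicator (Pi\<^sub>E I A) x \<partial>PiM I M)"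
      using I by (subst emeasure_density) (auto intro!: sets_PiM_I_finite A)
    also have "\<dots> = (\<integral>\<^sup>+x. (\<Prod>i\<in>I. f i (x i) * indicator (A i) (x i)) \<partial>PiM I M)"
      by (intro nn_integral_cong) (simp add: ind prod.distrib)
    also have "\<dots> = (\<Prod>i\<in>I. \<integral>\<^sup>+x. f i x * indicator (A i) x \<partial>M i)"
      using I by (intro M.product_nn_integral_prod) auto
    also have "\<dots> = (\<Prod>i\<in>I. emeasure (density (M i) (f i)) (A i))"
      by (intro prod.cong refl) (simp add: emeasure_density)
    finally show "emeasure (density (PiM I M) (\<lambda>x. \<Prod>i\<in>I. f i (x i))) (Pi\<^sub>E I A)
        = (\<Prod>i\<in>I. emeasure (density (M i) (f i)) (A i))" .
  qed (use I in \<open>auto intro!: sets_PiM_cong\<close>)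
qed

section \<open>Normal and exponential distributions\<close>

abbreviation normal :: "real \<Rightarrow> real measure" where
  "normal \<mu> \<equiv> density lborel (normal_density \<mu> 1)"

lemma prob_space_normal: "prob_space (normal \<mu>)"
  by (rule prob_space_normal_density) simp

text \<open>The density is at most 1 / sqrt (2 pi), hence at most 1/2, and the slab has length
  2r.\<close>

lemma normal_slab_le:
  assumes "0 \<le> r"
  shows "emeasure (normal \<mu>) {x. \<bar>x - t\<bar> \<le> r} \<le> ennreal r"
proof -
  have le: "normal_density \<mu> 1 x \<le> 1 / 2" for x
  proof -
    have "2 = sqrt 4" by simp
    also have "\<dots> \<le> sqrt (2 * pi)" using pi_gt3 by (intro real_sqrt_le_mono) simp
    finally have "1 / sqrt (2 * pi) \<le> 1 / 2" by (intro divide_left_mono) auto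
    moreover have "exp (- ((x - \<mu>)\<^sup>2 / 2)) \<le> 1" by simp
    ultimately have "1 / sqrt (2 * pi) * exp (- ((x - \<mu>)\<^sup>2 / 2)) \<le> 1 / 2 * 1"
      by (intro mult_mono) auto
    then show ?thesis by (simp add: normal_density_def)
  qed
  have eq: "{x. \<bar>x - t\<bar> \<le> r} = {t - r..t + r}" by auto
  have "emeasure (normal \<mu>) {t - r..t + r}
      = (\<integral>\<^sup>+x. ennreal (normal_density \<mu> 1 x) * indicator {t - r..t + r} x \<partial>lborel)"
    by (simp add: emeasure_density)
  also have "\<dots> \<le> (\<integral>\<^sup>+x. ennreal (1 / 2) * indicator {t - r..t + r} x \<partial>lborel)"
    by (intro nn_integral_mono mult_right_mono ennreal_leI le) simp
  also have "\<dots> = ennreal (1 / 2) * ennreal (2 * r)"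
    using assms by (subst nn_integral_cmult_indicator) auto
  also have "\<dots> = ennreal r"
    using assms by (subst ennreal_mult[symmetric]) auto
  finally show ?thesis by (simp add: eq)
qed

lemma normal_null_singleton: "emeasure (normal \<mu>) {t} = 0"
  using normal_slab_le[of 0 \<mu> t] by simp

text \<open>Reflection exchanges the two half lines up to the null point 0, so each carries half of
  the total mass.\<close>

lemma normal_0_nonneg_eq: "emeasure (normal 0) {0..} = 1 / 2"
  and normal_0_neg_eq: "emeasure (normal 0) {..<0} = 1 / 2"
proof -
  interpret prob_space "normal 0" by (rule prob_space_normal)
  have sym: "emeasure (normal 0) {..0} = emeasure (normal 0) {0..}"
  proof -
    have "emeasure (normal 0) {..0}
        = (\<integral>\<^sup>+x. ennreal (normal_density 0 1 x) * indicator {..0} x \<partial>lborel)"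
      by (simp add: emeasure_density)
    also have "\<dots> = (\<integral>\<^sup>+x. ennreal (normal_density 0 1 (- x)) * indicator {..0} (- x) \<partial>lborel)"
      by (subst nn_integral_real_affine[of _ "-1" 0]) auto
    also have "\<dots> = (\<integral>\<^sup>+x. ennreal (normal_density 0 1 x) * indicator {0..} x \<partial>lborel)"
      by (intro nn_integral_cong) (auto simp: normal_density_def indicator_def)
    also have "\<dots> = emeasure (normal 0) {0..}"
      by (simp add: emeasure_density)
    finally show ?thesis .
  qed
  have "emeasure (normal 0) {..0} = emeasure (normal 0) {..<0} + emeasure (normal 0) {0}"
    by (subst plus_emeasure) (auto intro!: arg_cong2[where f=emeasure])
  then have neg: "emeasure (normal 0) {..<0} = emeasure (normal 0) {0..}"
    using sym by (simp add: normal_null_singleton)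
  have "emeasure (normal 0) {..<0} + emeasure (normal 0) {0..} = emeasure (normal 0) UNIV"
    by (subst plus_emeasure) (auto intro!: arg_cong2[where f=emeasure])
  also have "\<dots> = 1" using emeasure_space_1 by simp
  finally have "prob {0..} = 1 / 2"
    using neg by (simp add: emeasure_eq_measure flip: ennreal_plus)
  then have "prob {0..} = 1 / 2" "prob {..<0} = 1 / 2"
    using neg by (simp_all add: emeasure_eq_measure)
  moreover have "ennreal (1 / 2) = 1 / 2"
    using divide_ennreal[of 1 2] by simp
  ultimately show "emeasure (normal 0) {0..} = 1 / 2" "emeasure (normal 0) {..<0} = 1 / 2"
    by (simp_all only: emeasure_eq_measure)
qed

lemma two_power_mult_half_power: "(2::ennreal) ^ n * (1 / 2) ^ n = 1"
  by (simp add: ennreal_times_divide flip: power_mult_distrib)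

text \<open>The half line contains an interval of length 1 and the density is positive everywhere.
  This makes the truncation sets admissible and the final constant positive.\<close>

lemma normal_pos:
  assumes "s = 1 \<or> s = - 1"
  shows "emeasure (normal \<mu>) {x. s * x \<le> 0} > 0"
proof -
  let ?A = "{x. s * x \<le> (0::real)}" and ?B = "if s = 1 then {-1..0} else {0..1::real}"
  have [measurable]: "?A \<in> sets borel" by measurable
  have "emeasure lborel ?B \<noteq> 0" by simp
  moreover have "emeasure lborel ?B \<le> emeasure lborel ?A"
    using assms by (intro emeasure_mono) auto
  ultimately have nz: "emeasure lborel ?A \<noteq> 0" by (auto simp del: emeasure_lborel_Icc)
  have "emeasure (normal \<mu>) ?A \<noteq> 0"
  proof
    assume "emeasure (normal \<mu>) ?A = 0"
    then have "AE x in lborel. ennreal (normal_density \<mu> 1 x) * indicator ?A x = 0"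
      by (simp add: emeasure_density nn_integral_0_iff_AE)
    then have "AE x in lborel. x \<notin> ?A"
    proof eventually_elim
      fix x assume "ennreal (normal_density \<mu> 1 x) * indicator ?A x = 0"
      then show "x \<notin> ?A"
        using normal_density_pos[of 1 \<mu> x] by (auto simp: indicator_def)
    qed
    then have "emeasure lborel ?A = 0"
      by (subst (asm) AE_iff_measurable[of ?A]) auto
    with nz show False by simp
  qed
  then show ?thesis by (simp add: zero_less_iff_neq_zero)
qed

abbreviation expo :: "real measure" where
  "expo \<equiv> density lborel (exponential_density 4)"

lemma prob_space_expo: "prob_space expo"
  by (rule prob_space_exponential_density) simp

text \<open>For y > 0 the clipping at 0 does not change the event and the exponential tail of rate 4
  results. For y \<le> 0 the clipping makes the event certain, which is the 1 in the
  minimum.\<close>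

lemma expo_tail: "emeasure expo {t. y \<le> max 0 t} = ennreal (min 1 (exp (- 4 * y)))"
proof (cases "y \<le> 0")
  case True
  interpret prob_space expo by (rule prob_space_expo)
  have "{t. y \<le> max 0 t} = space expo" using True by (auto simp: le_max_iff_disj)
  then show ?thesis using True emeasure_space_1 by simp
next
  case False
  interpret prob_space expo by (rule prob_space_expo)
  have "distributed expo lborel (\<lambda>x. x) (exponential_density 4)"
    unfolding distributed_def by (auto intro: distr_id2)
  from exponential_distributedD_gt[OF this, of y] False
  have gt: "prob {x. y < x} = exp (- 4 * y)" by (simp add: mult.commute)
  have "emeasure expo {y} = 0"
    by (simp add: emeasure_density nn_integral_0_iff_AE AE_lborel_singleton)
  moreover have "emeasure expo {t. y \<le> max 0 t} = emeasure expo {x. y < x} + emeasure expo {y}"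
    using False by (subst plus_emeasure) (auto intro!: arg_cong2[where f=emeasure] simp: le_max_iff_disj)
  ultimately show ?thesis using False gt by (simp add: emeasure_eq_measure)
qed

text \<open>Since ((x + 2)^2 - (x - 2)^2) / 2 = 4x, the density with mean -2 is exp (-4x) times the
  one with mean 2. Multiplying a density by the minimum of 1 and the ratio of the other density to
  it yields the minimum of both. This fixes the rate 4 of the thresholds.\<close>

lemma normal_tilt:
  assumes "s = 1 \<or> s = - 1"
  shows "normal_density (2 * s) 1 x * min 1 (exp (- 4 * (s * x)))
       = min (normal_density 2 1 x) (normal_density (- 2) 1 x)"
proof -
  have e: "normal_density 2 1 x * exp (- 4 * x) = normal_density (- 2) 1 x"
    "normal_density (- 2) 1 x * exp (4 * x) = normal_density 2 1 x"
    by (simp_all add: normal_density_def mult_exp_exp power2_eq_square field_simps)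
  show ?thesis
    using assms e by (elim disjE) (simp_all add: min_mult_distrib_left min.commute)
qed

section \<open>Randomly truncated Gaussians\<close>

lemma sets_gaussian [measurable_cong]: "sets (gaussian d \<mu>) = sets (Rd d)"
  unfolding gaussian_def Rd_def by (intro sets_PiM_cong) auto

lemma prob_space_gaussian: "prob_space (gaussian d \<mu>)"
  unfolding gaussian_def by (intro prob_space_PiM prob_space_normal)

lemma coordinate_measurable [measurable]: "i < d \<Longrightarrow> (\<lambda>x. x i) \<in> borel_measurable (Rd d)"
  unfolding Rd_def by measurable

lemma eucl_dist_measurable [measurable]: "(\<lambda>y. eucl_dist d y \<mu>) \<in> borel_measurable (Rd d)"
  unfolding eucl_dist_def L2_set_def by measurable

lemma abs_diff_le_eucl_dist: "i < d \<Longrightarrow> \<bar>x i - y i\<bar> \<le> eucl_dist d x y"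
  unfolding eucl_dist_def using member_le_L2_set[of "{..<d}" i "\<lambda>i. \<bar>x i - y i\<bar>"]
  by (simp add: L2_set_def)

lemma emeasure_gaussian_box:
  assumes "\<And>i. i < d \<Longrightarrow> A i \<in> sets borel"
  shows "emeasure (gaussian d \<mu>) (Pi\<^sub>E {..<d} A) = (\<Prod>i<d. emeasure (normal (\<mu> i)) (A i))"
proof -
  interpret product_sigma_finite "\<lambda>i. normal (\<mu> i)"
    using prob_space_normal
    by (auto simp: product_sigma_finite_def intro: prob_space_imp_sigma_finite)
  show ?thesis unfolding gaussian_def using assms by (intro emeasure_PiM) auto
qed

section \<open>Sign cells of the coordinates other than 0, and their Gaussian mass\<close>

definition cell :: "nat \<Rightarrow> (nat \<Rightarrow> real) \<Rightarrow> nat set" where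
  "cell d x = {i \<in> {1..<d}. 0 \<le> x i}"

lemma cell_in_Pow: "cell d x \<in> Pow {1..<d}"
  by (auto simp: cell_def)

lemma cell_measurable [measurable]: "cell d \<in> measurable (Rd d) (count_space (Pow {1..<d}))"
proof (rule measurable_count_space_eq2[THEN iffD2], simp, intro conjI ballI)
  show "cell d \<in> space (Rd d) \<rightarrow> Pow {1..<d}" using cell_in_Pow by auto
  fix c assume "c \<in> Pow {1..<d}"
  then have "cell d x = c \<longleftrightarrow> (\<forall>i\<in>{1..<d}. i \<in> c \<longleftrightarrow> 0 \<le> x i)" for x
    unfolding cell_def by blast
  then have "cell d -` {c} \<inter> space (Rd d) = {x \<in> space (Rd d). \<forall>i\<in>{1..<d}. i \<in> c \<longleftrightarrow> 0 \<le> x i}"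
    by blast
  also have "\<dots> \<in> sets (Rd d)" by measurable
  finally show "cell d -` {c} \<inter> space (Rd d) \<in> sets (Rd d)" .
qed

text \<open>The value s = 0 gives the standard Gaussian, so the facts on cells and step sets serve
  both the surface area and the two hypotheses s = 1 and s = -1.\<close>

definition mean :: "nat \<Rightarrow> real \<Rightarrow> nat \<Rightarrow> real" where
  "mean d s = (\<lambda>i\<in>{..<d}. if i = 0 then 2 * s else 0)"

lemma mean_in_space: "mean d s \<in> space (Rd d)"
  by (simp add: Rd_def space_PiM mean_def)

lemma std_gaussian_eq: "std_gaussian d = gaussian d (mean d 0)"
  by (simp add: mean_def cong: if_cong)

text \<open>The event is a box. All coordinates other than 0 are centered for every s, so each
  contributes 1/2 and the sign pattern carries no information on s.\<close>

lemma emeasure_gaussian_cell: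
  assumes d: "0 < d" and c: "c \<subseteq> {1..<d}" and A: "A \<in> sets borel"
  shows "emeasure (gaussian d (mean d s)) {x \<in> space (Rd d). cell d x = c \<and> x 0 \<in> A}
       = emeasure (normal (2 * s)) A * (1 / 2) ^ (d - 1)"
proof -
  let ?B = "\<lambda>i. if i = 0 then A else if i \<in> c then {0::real..} else {..<0}"
  have "{x \<in> space (Rd d). cell d x = c \<and> x 0 \<in> A} = Pi\<^sub>E {..<d} ?B"
  proof (intro set_eqI iffI)
    fix x assume "x \<in> {x \<in> space (Rd d). cell d x = c \<and> x 0 \<in> A}"
    then show "x \<in> Pi\<^sub>E {..<d} ?B"
      by (auto simp: Rd_def space_PiM PiE_iff cell_def not_le)
  next
    fix x assume x: "x \<in> Pi\<^sub>E {..<d} ?B"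
    then have "i \<in> c \<longleftrightarrow> 0 \<le> x i" if "i \<in> {1..<d}" for i
      using that by (auto simp: PiE_iff dest!: bspec[of _ _ i] split: if_splits)
    moreover have "x 0 \<in> A" using x d by (auto simp: PiE_iff dest!: bspec[of _ _ 0])
    ultimately show "x \<in> {x \<in> space (Rd d). cell d x = c \<and> x 0 \<in> A}"
      using x c by (auto simp: Rd_def space_PiM cell_def PiE_iff)
  qed
  then have "emeasure (gaussian d (mean d s)) {x \<in> space (Rd d). cell d x = c \<and> x 0 \<in> A}
      = (\<Prod>i<d. emeasure (normal (mean d s i)) (?B i))"
    using A by (simp add: emeasure_gaussian_box)
  also have "{..<d} = insert 0 {1..<d}" using d by auto
  also have "(\<Prod>i\<in>insert 0 {1..<d}. emeasure (normal (mean d s i)) (?B i))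
      = emeasure (normal (2 * s)) A * (\<Prod>i\<in>{1..<d}. 1 / 2)"
  proof -
    have "(\<Prod>i\<in>{1..<d}. emeasure (normal (mean d s i)) (?B i)) = (\<Prod>i\<in>{1..<d}. 1 / 2)"
      by (intro prod.cong refl) (auto simp: mean_def normal_0_nonneg_eq normal_0_neg_eq)
    then show ?thesis using d by (simp add: mean_def)
  qed
  finally show ?thesis by simp
qed

lemma emeasure_gaussian_coordinate:
  assumes i: "i < d" and A: "A \<in> sets borel"
  shows "emeasure (gaussian d \<mu>) {x \<in> space (Rd d). x i \<in> A} = emeasure (normal (\<mu> i)) A"
proof -
  let ?A = "\<lambda>j. if j = i then A else UNIV"
  have eq: "{x \<in> space (Rd d). x i \<in> A} = Pi\<^sub>E {..<d} ?A"
  proof (rule set_eqI)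
    fix x :: "nat \<Rightarrow> real"
    have "(\<forall>j\<in>{..<d}. x j \<in> ?A j) \<longleftrightarrow> x i \<in> A"
      using i by (metis UNIV_I lessThan_iff)
    then show "x \<in> {x \<in> space (Rd d). x i \<in> A} \<longleftrightarrow> x \<in> Pi\<^sub>E {..<d} ?A"
      unfolding Rd_def space_PiM PiE_iff mem_Collect_eq space_borel by (simp add: conj_commute)
  qed
  have "emeasure (gaussian d \<mu>) {x \<in> space (Rd d). x i \<in> A} = (\<Prod>j<d. emeasure (normal (\<mu> j)) (?A j))"
    unfolding eq using A by (intro emeasure_gaussian_box) simp
  also have "\<dots> = (\<Prod>j<d. if j = i then emeasure (normal (\<mu> i)) A else 1)"
    using prob_space.emeasure_space_1[OF prob_space_normal]
    by (intro prod.cong refl) (auto simp: space_density)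
  also have "\<dots> = emeasure (normal (\<mu> i)) A"
    using i by (simp add: prod.delta)
  finally show ?thesis .
qed

text \<open>Clipping at 0 makes the set contain the half space \<open>s * x 0 \<le> 0\<close> for
  every \<theta>, not just for almost every \<theta>. This gives a lower bound on its mass that is
  uniform in \<theta>.\<close>

definition step_set :: "nat \<Rightarrow> real \<Rightarrow> (nat set \<Rightarrow> real) \<Rightarrow> (nat \<Rightarrow> real) set" where
  "step_set d s \<theta> = {x \<in> space (Rd d). s * x 0 \<le> max 0 (\<theta> (cell d x))}"

lemma step_set_measurable [measurable]:
  assumes "0 < d" shows "step_set d s \<theta> \<in> sets (Rd d)"
proof -
  \<comment> \<open>Quantifying over the finitely many cells leaves only the constants
    \<open>\<theta> c\<close>, so an arbitrary \<theta> is allowed.\<close>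
  have "step_set d s \<theta>
      = {x \<in> space (Rd d). \<exists>c\<in>Pow {1..<d}. cell d x = c \<and> s * x 0 \<le> max 0 (\<theta> c)}"
    using cell_in_Pow by (auto simp: step_set_def)
  also have "\<dots> \<in> sets (Rd d)" using assms by measurable
  finally show ?thesis .
qed

text \<open>The bound depends neither on \<theta> nor on d. The mean parameter r is kept separate
  from s: r = 0 is used for admissibility, r = s for the normalizing constants.\<close>

lemma emeasure_step_set_ge:
  assumes d: "0 < d"
  shows "emeasure (gaussian d (mean d r)) (step_set d s \<theta>) \<ge> emeasure (normal (2 * r)) {x. s * x \<le> 0}"
proof -
  have "emeasure (gaussian d (mean d r)) {x \<in> space (Rd d). x 0 \<in> {x. s * x \<le> 0}}
      = emeasure (normal (mean d r 0)) {x. s * x \<le> 0}"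
    by (rule emeasure_gaussian_coordinate[OF d]) measurable
  moreover have "emeasure (gaussian d (mean d r)) {x \<in> space (Rd d). x 0 \<in> {x. s * x \<le> 0}}
      \<le> emeasure (gaussian d (mean d r)) (step_set d s \<theta>)"
    using step_set_measurable[OF d]
    by (intro emeasure_mono) (auto simp: step_set_def sets_gaussian)
  ultimately show ?thesis using d by (simp add: mean_def)
qed

lemma step_set_truncation_set:
  assumes d: "0 < d" and s: "s = 1 \<or> s = - 1"
  shows "step_set d s \<theta> \<in> truncation_sets d"
proof -
  have "0 < emeasure (std_gaussian d) (step_set d s \<theta>)"
    unfolding std_gaussian_eq
    using normal_pos[OF s, of 0] emeasure_step_set_ge[OF d, where r = 0 and s = s and \<theta> = \<theta>] by simp
  then show ?thesis using step_set_measurable[OF d] by (simp add: truncation_sets_def)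
qed

section \<open>Gaussian surface area of the step sets\<close>

lemma enlargement_step_set_subset:
  assumes d: "0 < d" and s: "s = 1 \<or> s = - 1" and \<delta>: "0 < \<delta>"
  shows "enlargement d (step_set d s \<theta>) \<delta> - step_set d s \<theta>
    \<subseteq> (\<Union>i\<in>{1..<d}. {x \<in> space (Rd d). x i \<in> {y. \<bar>y - 0\<bar> \<le> 2 * \<delta>}})
      \<union> (\<Union>c\<in>Pow {1..<d}. {x \<in> space (Rd d). cell d x = c
            \<and> x 0 \<in> {y. \<bar>y - s * max 0 (\<theta> c)\<bar> \<le> 2 * \<delta>}})"
    (is "_ \<subseteq> ?U \<union> ?V")
proof
  fix x assume "x \<in> enlargement d (step_set d s \<theta>) \<delta> - step_set d s \<theta>"
  then have x: "x \<in> space (Rd d)" and x_out: "s * x 0 > max 0 (\<theta> (cell d x))"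
    and dist: "dist_to_set d x (step_set d s \<theta>) \<le> ennreal \<delta>"
    by (auto simp: enlargement_def step_set_def not_le)
  \<comment> \<open>The infimum defining the distance need not be attained; relaxing \<delta> to
    2\<delta> gives a strict inequality and hence an actual nearby point of the set.\<close>
  have "ennreal \<delta> < ennreal (2 * \<delta>)" using \<delta> by (simp add: ennreal_less_iff)
  with dist have "dist_to_set d x (step_set d s \<theta>) < ennreal (2 * \<delta>)" by simp
  then obtain a where a: "a \<in> step_set d s \<theta>" and "eucl_dist d x a < 2 * \<delta>"
    using \<delta> by (auto simp: dist_to_set_def Inf_less_iff ennreal_less_iff eucl_dist_def)
  then have close: "\<bar>x i - a i\<bar> < 2 * \<delta>" if "i < d" for i
    using abs_diff_le_eucl_dist[OF that, of x a] by simp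
  show "x \<in> ?U \<union> ?V"
  \<comment> \<open>In a common cell, \<open>s * x 0\<close> and \<open>s * a 0\<close> lie on
    different sides of the same threshold. Otherwise some coordinate changes sign between the two
    points and is therefore close to 0.\<close>
  proof (cases "cell d x = cell d a")
    case True
    then have "s * a 0 \<le> max 0 (\<theta> (cell d x))" using a by (simp add: step_set_def)
    then have "\<bar>x 0 - s * max 0 (\<theta> (cell d x))\<bar> \<le> 2 * \<delta>"
      using x_out close[OF d] s by auto
    then show ?thesis using x cell_in_Pow[of d x] by blast
  next
    case False
    then obtain i where i: "i \<in> {1..<d}" and "0 \<le> x i \<longleftrightarrow> \<not> 0 \<le> a i"
      by (auto simp: cell_def)
    then have "\<bar>x i - 0\<bar> \<le> 2 * \<delta>" using close[of i] by auto
    then show ?thesis using x i by blast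
  qed
qed

text \<open>By the union bound, each of the d - 1 coordinate hyperplanes costs at most 2\<delta>. A
  threshold face costs this only in proportion to the mass of its cell, so the exponentially many
  faces together cost no more than one hyperplane.\<close>

lemma emeasure_enlargement_step_set_le:
  assumes d: "0 < d" and s: "s = 1 \<or> s = - 1" and \<delta>: "0 < \<delta>"
  shows "emeasure (std_gaussian d) (enlargement d (step_set d s \<theta>) \<delta> - step_set d s \<theta>)
    \<le> ennreal (2 * real d) * ennreal \<delta>"
proof -
  let ?G = "gaussian d (mean d 0)"
  let ?U = "\<lambda>i. {x \<in> space (Rd d). x i \<in> {y. \<bar>y - 0\<bar> \<le> 2 * \<delta>}}"
  let ?V = "\<lambda>c. {x \<in> space (Rd d). cell d x = c \<and> x 0 \<in> {y. \<bar>y - s * max 0 (\<theta> c)\<bar> \<le> 2 * \<delta>}}"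
  have slab [measurable]: "{y. \<bar>y - t\<bar> \<le> 2 * \<delta>} \<in> sets borel" for t :: real by measurable
  have U [measurable]: "?U i \<in> sets ?G" if "i \<in> {1..<d}" for i
    using that by (auto simp: sets_gaussian)
  have V [measurable]: "?V c \<in> sets ?G" if "c \<in> Pow {1..<d}" for c
    using that d unfolding sets_gaussian by measurable
  have "emeasure ?G (enlargement d (step_set d s \<theta>) \<delta> - step_set d s \<theta>)
      \<le> emeasure ?G ((\<Union>i\<in>{1..<d}. ?U i) \<union> (\<Union>c\<in>Pow {1..<d}. ?V c))"
    by (intro emeasure_mono enlargement_step_set_subset[OF d s \<delta>] sets.Un sets.finite_UN U V) auto
  also have "\<dots> \<le> emeasure ?G (\<Union>i\<in>{1..<d}. ?U i) + emeasure ?G (\<Union>c\<in>Pow {1..<d}. ?V c)"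
    by (intro emeasure_subadditive sets.finite_UN U V) auto
  also have "\<dots> \<le> (\<Sum>i\<in>{1..<d}. emeasure ?G (?U i)) + (\<Sum>c\<in>Pow {1..<d}. emeasure ?G (?V c))"
    using U V by (intro add_mono emeasure_subadditive_finite) auto
  also have "\<dots> \<le> (\<Sum>i\<in>{1..<d}. ennreal (2 * \<delta>)) + (\<Sum>c\<in>Pow {1..<d}. ennreal (2 * \<delta>) * (1 / 2) ^ (d - 1))"
  proof (intro add_mono sum_mono)
    fix i assume "i \<in> {1..<d}"
    then show "emeasure ?G (?U i) \<le> ennreal (2 * \<delta>)"
      using \<delta> by (subst emeasure_gaussian_coordinate) (auto intro!: normal_slab_le[of _ _ 0, simplified])
  next
    fix c assume "c \<in> Pow {1..<d}"
    then show "emeasure ?G (?V c) \<le> ennreal (2 * \<delta>) * (1 / 2) ^ (d - 1)"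
      using \<delta> d by (subst emeasure_gaussian_cell) (auto intro!: mult_right_mono normal_slab_le)
  qed
  also have "(\<Sum>i\<in>{1..<d}. ennreal (2 * \<delta>)) = ennreal (2 * \<delta> * real (d - 1))"
    using \<delta> by (simp add: ennreal_of_nat_eq_real_of_nat mult.commute flip: ennreal_mult)
  \<comment> \<open>The number 2^(d-1) of cells cancels the mass 2^-(d-1) of each.\<close>
  also have "(\<Sum>c\<in>Pow {1..<d}. ennreal (2 * \<delta>) * (1 / 2) ^ (d - 1)) = ennreal (2 * \<delta>) * 1"
    by (subst two_power_mult_half_power[of "d - 1", symmetric]) (simp add: card_Pow mult_ac)
  also have "ennreal (2 * \<delta> * real (d - 1)) + ennreal (2 * \<delta>) * 1 = ennreal (2 * real d) * ennreal \<delta>"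
    using \<delta> d by (simp add: of_nat_diff algebra_simps flip: ennreal_plus ennreal_mult)
  finally show ?thesis by (simp add: std_gaussian_eq)
qed

lemma surface_area_step_set_le:
  assumes d: "0 < d" and s: "s = 1 \<or> s = - 1"
  shows "gaussian_surface_area d (step_set d s \<theta>) \<le> ennreal (2 * real d)"
proof -
  have "\<forall>\<^sub>F \<delta> in at_right 0. emeasure (std_gaussian d)
      (enlargement d (step_set d s \<theta>) \<delta> - step_set d s \<theta>) / ennreal \<delta> \<le> ennreal (2 * real d)"
    using eventually_at_right_less[of "0::real"]
  proof eventually_elim
    case (elim \<delta>)
    then show ?case
      using emeasure_enlargement_step_set_le[OF d s elim, of \<theta>]
      by (subst divide_le_posI_ennreal) (auto simp: mult.commute)
  qed
  then have "gaussian_surface_area d (step_set d s \<theta>)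
      \<le> Liminf (at_right (0::real)) (\<lambda>_. ennreal (2 * real d))"
    unfolding gaussian_surface_area_def by (rule Liminf_mono)
  then show ?thesis by (simp add: Liminf_const)
qed

section \<open>Averaging over the truncation set\<close>

text \<open>Supplies the side condition of \<open>PiM_density\<close> for survival weights, whose
  densities give subprobability measures.\<close>

lemma sigma_finite_density_le_1:
  assumes M: "prob_space M" and f [measurable]: "f \<in> borel_measurable M"
    and le: "\<And>x. x \<in> space M \<Longrightarrow> f x \<le> (1 :: ennreal)"
  shows "sigma_finite_measure (density M f)"
proof -
  interpret prob_space M by fact
  have "emeasure (density M f) (space M) = (\<integral>\<^sup>+x. f x \<partial>M)"
    by (subst emeasure_density) (auto intro!: nn_integral_cong)
  also have "\<dots> \<le> (\<integral>\<^sup>+x. 1 \<partial>M)" by (intro nn_integral_mono le)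
  also have "\<dots> = 1" using emeasure_space_1 by simp
  finally have "emeasure (density M f) (space M) \<le> 1" .
  then have "finite_measure (density M f)"
    by (intro finite_measureI) (auto simp: top_unique)
  then show ?thesis by (simp add: finite_measure_def)
qed

text \<open>By \<open>expo_tail\<close>, this is the probability that a clipped random threshold is
  at least \<open>s * x\<close>.\<close>

definition survival :: "real \<Rightarrow> real \<Rightarrow> ennreal" where
  "survival s x = ennreal (min 1 (exp (- 4 * (s * x))))"

lemma survival_measurable [measurable]: "survival s \<in> borel_measurable borel"
  unfolding survival_def by measurable

lemma survival_le_1: "survival s x \<le> 1"
  by (simp add: survival_def)

text \<open>Left unnormalized on purpose: only the unnormalized laws are compared between the two
  signs.\<close>

definition averaged :: "nat \<Rightarrow> real \<Rightarrow> (nat \<Rightarrow> real) measure" where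
  "averaged d s = density (gaussian d (mean d s)) (\<lambda>x. survival s (x 0))"

text \<open>For either sign the measure is the same explicit product: coordinate 0 has the minimum
  of the two densities by \<open>normal_tilt\<close>, all others are standard normal.\<close>

lemma averaged_eq:
  assumes d: "0 < d"
  shows "averaged d 1 = averaged d (- 1)"
proof -
  have eq: "averaged d s = PiM {..<d} (\<lambda>i. density lborel (\<lambda>x.
      ennreal (if i = 0 then min (normal_density 2 1 x) (normal_density (- 2) 1 x)
               else normal_density 0 1 x)))"
    if s: "s = 1 \<or> s = - 1" for s
  proof -
    let ?v = "\<lambda>i::nat. if i = 0 then survival s else (\<lambda>_. 1)"
    have "(\<Prod>i<d. ?v i (x i)) = survival s (x 0)" for x
    proof -
      have "(\<Prod>i<d. ?v i (x i)) = (\<Prod>i<d. if i = 0 then survival s (x 0) else 1)"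
        by (intro prod.cong) auto
      then show ?thesis using d by (simp add: prod.delta)
    qed
    then have "averaged d s = density (gaussian d (mean d s)) (\<lambda>x. \<Prod>i<d. ?v i (x i))"
      by (simp add: averaged_def)
    also have "\<dots> = PiM {..<d} (\<lambda>i. density (normal (mean d s i)) (?v i))"
      unfolding gaussian_def
      by (intro PiM_density[symmetric] prob_space_imp_sigma_finite sigma_finite_density_le_1
            prob_space_normal) (auto simp: survival_le_1)
    also have "\<dots> = PiM {..<d} (\<lambda>i. density lborel (\<lambda>x.
      ennreal (if i = 0 then min (normal_density 2 1 x) (normal_density (- 2) 1 x)
               else normal_density 0 1 x)))"
    proof (intro PiM_cong refl)
      fix i assume "i \<in> {..<d}"
      show "density (normal (mean d s i)) (?v i) = density lborel (\<lambda>x.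
          ennreal (if i = 0 then min (normal_density 2 1 x) (normal_density (- 2) 1 x)
                   else normal_density 0 1 x))"
        using \<open>i \<in> {..<d}\<close>
        by (subst density_density_eq)
           (auto simp: mean_def survival_def normal_tilt[OF s, symmetric] ennreal_mult)
    qed
    finally show ?thesis .
  qed
  show ?thesis by (simp add: eq)
qed

definition prior :: "nat \<Rightarrow> (nat set \<Rightarrow> real) measure" where
  "prior d = PiM (Pow {1..<d}) (\<lambda>_. expo)"

lemma prob_space_prior: "prob_space (prior d)"
  unfolding prior_def by (intro prob_space_PiM prob_space_expo)

lemma prior_component_measurable [measurable]:
  "c \<in> Pow {1..<d} \<Longrightarrow> (\<lambda>\<theta>. \<theta> c) \<in> borel_measurable (prior d)"
  unfolding prior_def using measurable_component_singleton[of c "Pow {1..<d}" "\<lambda>_. expo"]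
  by (simp cong: measurable_cong_sets)

section \<open>Integrating out the random thresholds\<close>

abbreviation samples :: "nat \<Rightarrow> nat \<Rightarrow> (nat \<Rightarrow> nat \<Rightarrow> real) measure" where
  "samples d m \<equiv> PiM {..<m} (\<lambda>_. Rd d)"

text \<open>Joint measurability in thresholds and samples is what the exchange of the two
  integrations requires.\<close>

lemma step_set_jointly_measurable:
  assumes d: "0 < d" and i: "i < m"
  shows "(\<lambda>p. indicator (step_set d s (fst p)) (snd p i) :: ennreal)
    \<in> borel_measurable (prior d \<Otimes>\<^sub>M samples d m)"
proof -
  let ?M = "prior d \<Otimes>\<^sub>M samples d m"
  have comp [measurable]: "(\<lambda>p. snd p i) \<in> measurable ?M (Rd d)"
    by (rule measurable_compose[OF measurable_snd measurable_component_singleton]) (use i in simp)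
  have [measurable]: "(\<lambda>p. snd p i 0) \<in> borel_measurable ?M"
    using measurable_compose[OF comp coordinate_measurable[OF d]] .
  have "{p \<in> space ?M. snd p i \<in> step_set d s (fst p)}
      = {p \<in> space ?M. \<exists>c\<in>Pow {1..<d}. cell d (snd p i) = c \<and> s * snd p i 0 \<le> max 0 (fst p c)}"
    using measurable_space[OF comp] cell_in_Pow by (auto simp: step_set_def)
  also have "\<dots> \<in> sets ?M" by measurable
  finally show ?thesis by (rule borel_measurable_indicator')
qed

definition distinct_cells :: "nat \<Rightarrow> nat \<Rightarrow> (nat \<Rightarrow> nat \<Rightarrow> real) set" where
  "distinct_cells d m = {x \<in> space (samples d m). inj_on (\<lambda>i. cell d (x i)) {..<m}}"

text \<open>Samples in distinct cells are truncated by independent thresholds.\<close>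

lemma nn_integral_prior_distinct:
  assumes x: "x \<in> distinct_cells d m"
  shows "(\<integral>\<^sup>+\<theta>. (\<Prod>i<m. indicator (step_set d s \<theta>) (x i)) \<partial>prior d) = (\<Prod>i<m. survival s (x i 0))"
proof -
  interpret product_sigma_finite "\<lambda>_::nat set. expo"
    using prob_space_expo by (auto simp: product_sigma_finite_def intro: prob_space_imp_sigma_finite)
  let ?f = "\<lambda>i. cell d (x i)"
  have sp: "x i \<in> space (Rd d)" if "i < m" for i
    using x that by (auto simp: distinct_cells_def space_PiM PiE_iff)
  have inj: "inj_on ?f {..<m}" using x by (simp add: distinct_cells_def)
  \<comment> \<open>\<open>g c\<close> collects the constraints that the samples in cell c put on
    its threshold. Regrouping the product by cells lets independence of the thresholds factor the
    integral.\<close>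
  define g where "g c t = (\<Prod>i\<in>{i\<in>{..<m}. ?f i = c}. indicator {t. s * x i 0 \<le> max 0 t} t :: ennreal)"
    for c and t :: real
  have tail [measurable]: "{t. y \<le> max 0 t} \<in> sets borel" for y :: real
    by measurable
  have [measurable]: "g c \<in> borel_measurable expo" for c
    unfolding g_def by (intro borel_measurable_prod_ennreal borel_measurable_indicator) (simp add: tail)
  have "(\<Prod>i<m. indicator (step_set d s \<theta>) (x i)) = (\<Prod>c\<in>Pow {1..<d}. g c (\<theta> c))" for \<theta>
  proof -
    have "(\<Prod>c\<in>Pow {1..<d}. g c (\<theta> c))
        = (\<Prod>c\<in>Pow {1..<d}. \<Prod>i\<in>{i\<in>{..<m}. ?f i = c}. indicator {t. s * x i 0 \<le> max 0 t} (\<theta> (?f i)))"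
      unfolding g_def by (intro prod.cong refl) auto
    also have "\<dots> = (\<Prod>i<m. indicator {t. s * x i 0 \<le> max 0 t} (\<theta> (?f i)))"
      using cell_in_Pow by (intro prod.group) auto
    also have "\<dots> = (\<Prod>i<m. indicator (step_set d s \<theta>) (x i))"
      using sp by (intro prod.cong refl) (auto simp: indicator_def step_set_def)
    finally show ?thesis by simp
  qed
  then have "(\<integral>\<^sup>+\<theta>. (\<Prod>i<m. indicator (step_set d s \<theta>) (x i)) \<partial>prior d)
      = (\<Prod>c\<in>Pow {1..<d}. \<integral>\<^sup>+t. g c t \<partial>expo)"
    unfolding prior_def by (simp add: product_nn_integral_prod)
  \<comment> \<open>A cell without samples gives the empty product, whose integral is 1.\<close>
  also have "\<dots> = (\<Prod>c\<in>?f ` {..<m}. \<integral>\<^sup>+t. g c t \<partial>expo)"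
  proof (intro prod.mono_neutral_right ballI)
    fix c assume "c \<in> Pow {1..<d} - ?f ` {..<m}"
    then have empty: "{i\<in>{..<m}. ?f i = c} = {}" by auto
    have "g c = (\<lambda>_. 1)" unfolding g_def empty by simp
    then show "(\<integral>\<^sup>+t. g c t \<partial>expo) = 1"
      using prob_space.emeasure_space_1[OF prob_space_expo] by simp
  qed (use cell_in_Pow in auto)
  also have "\<dots> = (\<Prod>i<m. \<integral>\<^sup>+t. g (?f i) t \<partial>expo)"
    using inj by (simp add: prod.reindex)
  also have "\<dots> = (\<Prod>i<m. survival s (x i 0))"
  proof (intro prod.cong refl)
    fix i assume i: "i \<in> {..<m}"
    \<comment> \<open>Here distinctness enters: each occupied cell constrains its threshold by one
      sample only.\<close>
    then have "{j\<in>{..<m}. ?f j = ?f i} = {i}" using inj by (auto simp: inj_on_def)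
    then have "(\<integral>\<^sup>+t. g (?f i) t \<partial>expo) = (\<integral>\<^sup>+t. indicator {t. s * x i 0 \<le> max 0 t} t \<partial>expo)"
      by (simp add: g_def)
    also have "\<dots> = survival s (x i 0)"
      unfolding survival_def by (subst nn_integral_indicator) (auto simp: expo_tail)
    finally show "(\<integral>\<^sup>+t. g (?f i) t \<partial>expo) = survival s (x i 0)" .
  qed
  finally show ?thesis .
qed

lemma sets_PiM_gaussian [measurable_cong]:
  "sets (PiM {..<m} (\<lambda>_. gaussian d \<mu>)) = sets (samples d m)"
  by (intro sets_PiM_cong refl sets_gaussian)

lemma prob_space_PiM_gaussian: "prob_space (PiM {..<m} (\<lambda>_. gaussian d \<mu>))"
  by (intro prob_space_PiM prob_space_gaussian)

text \<open>After exchanging the integrals, \<open>nn_integral_prior_distinct\<close> evaluates the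
  inner one wherever h can be nonzero. The survival factors are then absorbed into the measure of
  each sample by \<open>PiM_density\<close>.\<close>

lemma nn_integral_prior_average:
  assumes d: "0 < d" and h [measurable]: "h \<in> borel_measurable (samples d m)"
    and supp: "\<And>x. x \<in> space (samples d m) \<Longrightarrow> x \<notin> distinct_cells d m \<Longrightarrow> h x = 0"
  shows "(\<integral>\<^sup>+\<theta>. \<integral>\<^sup>+x. (\<Prod>i<m. indicator (step_set d s \<theta>) (x i)) * h x
            \<partial>PiM {..<m} (\<lambda>_. gaussian d (mean d s)) \<partial>prior d)
       = (\<integral>\<^sup>+x. h x \<partial>PiM {..<m} (\<lambda>_. averaged d s))"
proof -
  let ?G = "PiM {..<m} (\<lambda>_. gaussian d (mean d s))"
  interpret pair_sigma_finite ?G "prior d"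
    by (intro pair_sigma_finite.intro prob_space_imp_sigma_finite prob_space_prior
        prob_space_PiM_gaussian)
  have [measurable]: "(\<lambda>(x, \<theta>). \<Prod>i<m. indicator (step_set d s \<theta>) (x i) :: ennreal)
      \<in> borel_measurable (samples d m \<Otimes>\<^sub>M prior d)"
  proof -
    have "(\<lambda>p. \<Prod>i<m. indicator (step_set d s (fst p)) (snd p i) :: ennreal)
        \<in> borel_measurable (prior d \<Otimes>\<^sub>M samples d m)"
      by (intro borel_measurable_prod_ennreal step_set_jointly_measurable d) auto
    from measurable_compose[OF measurable_pair_swap' this] show ?thesis
      by (simp add: case_prod_beta)
  qed
  have "(\<integral>\<^sup>+\<theta>. \<integral>\<^sup>+x. (\<Prod>i<m. indicator (step_set d s \<theta>) (x i)) * h x \<partial>?G \<partial>prior d)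
      = (\<integral>\<^sup>+x. \<integral>\<^sup>+\<theta>. (\<Prod>i<m. indicator (step_set d s \<theta>) (x i)) * h x \<partial>prior d \<partial>?G)"
    by (rule Fubini') measurable
  also have "\<dots> = (\<integral>\<^sup>+x. (\<integral>\<^sup>+\<theta>. (\<Prod>i<m. indicator (step_set d s \<theta>) (x i)) \<partial>prior d) * h x \<partial>?G)"
  proof (intro nn_integral_cong nn_integral_multc)
    fix x assume "x \<in> space ?G"
    then have [measurable]: "x \<in> space (samples d m)"
      using sets_eq_imp_space_eq[OF sets_PiM_gaussian] by blast
    show "(\<lambda>\<theta>. \<Prod>i<m. indicator (step_set d s \<theta>) (x i) :: ennreal) \<in> borel_measurable (prior d)"
      by measurable
  qed
  also have "\<dots> = (\<integral>\<^sup>+x. (\<Prod>i<m. survival s (x i 0)) * h x \<partial>?G)"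
  proof (intro nn_integral_cong)
    fix x assume "x \<in> space ?G"
    then have "x \<in> space (samples d m)"
      using sets_eq_imp_space_eq[OF sets_PiM_gaussian] by blast
    then show "(\<integral>\<^sup>+\<theta>. (\<Prod>i<m. indicator (step_set d s \<theta>) (x i)) \<partial>prior d) * h x
        = (\<Prod>i<m. survival s (x i 0)) * h x"
      using supp by (cases "x \<in> distinct_cells d m") (auto simp: nn_integral_prior_distinct)
  qed
  also have "\<dots> = (\<integral>\<^sup>+x. h x \<partial>density ?G (\<lambda>x. \<Prod>i<m. survival s (x i 0)))"
  proof -
    have [measurable]: "(\<lambda>x. survival s (x i 0)) \<in> borel_measurable (samples d m)" if "i < m" for i
    proof -
      have c: "(\<lambda>x. x i) \<in> measurable (samples d m) (Rd d)"
        by (rule measurable_component_singleton) (use that in simp)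
      have "(\<lambda>x. survival s (x 0)) \<in> borel_measurable (Rd d)"
        using d by measurable
      from measurable_compose[OF c this] show ?thesis .
    qed
    show ?thesis by (subst nn_integral_density) (auto intro!: borel_measurable_prod_ennreal)
  qed
  also have "density ?G (\<lambda>x. \<Prod>i<m. survival s (x i 0)) = PiM {..<m} (\<lambda>_. averaged d s)"
    unfolding averaged_def using d
    by (intro PiM_density[symmetric] prob_space_imp_sigma_finite sigma_finite_density_le_1
          prob_space_gaussian) (auto simp: survival_le_1)
  finally show ?thesis .
qed

section \<open>Collisions\<close>

lemma emeasure_PiM_two_components:
  assumes M: "prob_space M" and A [measurable]: "A \<in> sets M" and I: "finite I" "i \<in> I" "j \<in> I" "i \<noteq> j"
  shows "emeasure (PiM I (\<lambda>_. M)) {x \<in> space (PiM I (\<lambda>_. M)). x i \<in> A \<and> x j \<in> A}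
       = emeasure M A * emeasure M A"
proof -
  interpret M: prob_space M by fact
  interpret product_sigma_finite "\<lambda>_. M"
    using M by (auto simp: product_sigma_finite_def intro: prob_space_imp_sigma_finite)
  let ?B = "\<lambda>k. if k = i \<or> k = j then A else space M"
  have "{x \<in> space (PiM I (\<lambda>_. M)). x i \<in> A \<and> x j \<in> A} = Pi\<^sub>E I ?B"
  proof (rule set_eqI)
    fix x
    have "(\<forall>k\<in>I. x k \<in> ?B k) \<longleftrightarrow> (\<forall>k\<in>I. x k \<in> space M) \<and> x i \<in> A \<and> x j \<in> A"
      using I sets.sets_into_space[OF A] by (auto split: if_splits)
    then show "x \<in> {x \<in> space (PiM I (\<lambda>_. M)). x i \<in> A \<and> x j \<in> A} \<longleftrightarrow> x \<in> Pi\<^sub>E I ?B"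
      unfolding space_PiM PiE_iff mem_Collect_eq by blast
  qed
  then have "emeasure (PiM I (\<lambda>_. M)) {x \<in> space (PiM I (\<lambda>_. M)). x i \<in> A \<and> x j \<in> A}
      = (\<Prod>k\<in>I. emeasure M (?B k))"
    using I by (simp only:) (intro emeasure_PiM, auto)
  also have "\<dots> = (\<Prod>k\<in>{i, j}. emeasure M (?B k))"
    using I by (intro prod.mono_neutral_right) (auto simp: M.emeasure_space_1)
  also have "\<dots> = emeasure M A * emeasure M A" using I by simp
  finally show ?thesis .
qed

lemma same_cell_measurable [measurable]:
  assumes "i < m" "j < m"
  shows "{x \<in> space (samples d m). cell d (x i) = cell d (x j)} \<in> sets (samples d m)"
proof -
  have [measurable]: "(\<lambda>x. x k) \<in> measurable (samples d m) (Rd d)" if "k < m" for k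
    by (rule measurable_component_singleton) (use that in simp)
  have "{x \<in> space (samples d m). cell d (x i) = cell d (x j)}
      = {x \<in> space (samples d m). \<exists>c\<in>Pow {1..<d}. cell d (x i) = c \<and> cell d (x j) = c}"
    using cell_in_Pow by auto
  also have "\<dots> \<in> sets (samples d m)" using assms by measurable
  finally show ?thesis .
qed

lemma distinct_cells_compl:
  "space (samples d m) - distinct_cells d m
    = (\<Union>q\<in>{(i, j). i < m \<and> j < m \<and> i \<noteq> j}.
        {x \<in> space (samples d m). cell d (x (fst q)) = cell d (x (snd q))})"
  by (auto simp: distinct_cells_def inj_on_def)

lemma finite_pairs: "finite {(i, j). i < m \<and> j < m \<and> i \<noteq> (j::nat)}"
  by (rule finite_subset[of _ "{..<m} \<times> {..<m}"]) auto

lemma distinct_cells_measurable [measurable]: "distinct_cells d m \<in> sets (samples d m)"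
proof -
  have "space (samples d m) - distinct_cells d m \<in> sets (samples d m)"
    unfolding distinct_cells_compl by (intro sets.finite_UN finite_pairs) auto
  then have "space (samples d m) - (space (samples d m) - distinct_cells d m) \<in> sets (samples d m)"
    by (rule sets.compl_sets)
  then show ?thesis by (simp add: double_diff distinct_cells_def)
qed

text \<open>Birthday bound: there are at most m^2 ordered pairs, and by independence a pair meets in
  a given one of the 2^(d-1) cells with probability at most p^2.\<close>

lemma emeasure_collision_le:
  assumes M: "prob_space M" and sets: "sets M = sets (Rd d)"
    and p: "\<And>c. c \<in> Pow {1..<d} \<Longrightarrow> emeasure M {x \<in> space (Rd d). cell d x = c} \<le> ennreal p" "0 \<le> p"
  shows "emeasure (PiM {..<m} (\<lambda>_. M)) (space (samples d m) - distinct_cells d m)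
       \<le> ennreal (real m ^ 2 * (2 ^ (d - 1) * p ^ 2))"
proof -
  let ?N = "PiM {..<m} (\<lambda>_. M)"
  have sets_N: "sets ?N = sets (samples d m)" by (intro sets_PiM_cong refl sets)
  note space_N = sets_eq_imp_space_eq[OF sets_N]
  have space_M: "space M = space (Rd d)" by (rule sets_eq_imp_space_eq[OF sets])
  have comp [measurable]: "(\<lambda>x. x k) \<in> measurable (samples d m) (Rd d)" if "k < m" for k
    by (rule measurable_component_singleton) (use that in simp)
  have pair: "emeasure ?N {x \<in> space (samples d m). cell d (x i) = cell d (x j)}
      \<le> ennreal (2 ^ (d - 1) * p ^ 2)" if ij: "i < m" "j < m" "i \<noteq> j" for i j
  proof -
    let ?C = "\<lambda>c. {x \<in> space (Rd d). cell d x = c}"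
    let ?P = "\<lambda>c. {x \<in> space ?N. x i \<in> ?C c \<and> x j \<in> ?C c}"
    have C: "?C c \<in> sets M" if "c \<in> Pow {1..<d}" for c
      using that unfolding sets by measurable
    have P: "?P c \<in> sets ?N" if c: "c \<in> Pow {1..<d}" for c
      unfolding sets_N space_N using ij C[OF c] unfolding sets by measurable
    have "{x \<in> space (samples d m). cell d (x i) = cell d (x j)} = (\<Union>c\<in>Pow {1..<d}. ?P c)"
      using ij measurable_space[OF comp] cell_in_Pow by (auto simp: space_N)
    then have "emeasure ?N {x \<in> space (samples d m). cell d (x i) = cell d (x j)}
        \<le> (\<Sum>c\<in>Pow {1..<d}. emeasure ?N (?P c))"
      using P by (simp only:) (intro emeasure_subadditive_finite, auto)
    also have "\<dots> = (\<Sum>c\<in>Pow {1..<d}. emeasure M (?C c) * emeasure M (?C c))"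
      using ij by (intro sum.cong refl emeasure_PiM_two_components[OF M C]) auto
    also have "\<dots> \<le> (\<Sum>c\<in>Pow {1..<d}. ennreal p * ennreal p)"
      using p by (intro sum_mono mult_mono) auto
    also have "\<dots> = ennreal (2 ^ (d - 1) * p ^ 2)"
      using p(2) by (simp add: card_Pow power2_eq_square ennreal_mult flip: ennreal_power)
    finally show ?thesis .
  qed
  let ?I = "{(i, j). i < m \<and> j < m \<and> i \<noteq> j}"
  have "emeasure ?N (space (samples d m) - distinct_cells d m)
      \<le> (\<Sum>q\<in>?I. emeasure ?N {x \<in> space (samples d m). cell d (x (fst q)) = cell d (x (snd q))})"
    unfolding distinct_cells_compl
    by (intro emeasure_subadditive_finite finite_pairs) (auto simp: sets_N)
  also have "\<dots> \<le> (\<Sum>q\<in>?I. ennreal (2 ^ (d - 1) * p ^ 2))"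
    using pair by (intro sum_mono) auto
  also have "\<dots> = of_nat (card ?I) * ennreal (2 ^ (d - 1) * p ^ 2)" by simp
  also have "\<dots> \<le> of_nat (m * m) * ennreal (2 ^ (d - 1) * p ^ 2)"
  proof -
    have "card ?I \<le> card ({..<m} \<times> {..<m})" by (intro card_mono) auto
    then have "card ?I \<le> m * m" by (simp only: card_cartesian_product card_lessThan)
    then show ?thesis by (intro mult_right_mono of_nat_mono) auto
  qed
  also have "\<dots> = ennreal (real m ^ 2 * (2 ^ (d - 1) * p ^ 2))"
    by (simp add: ennreal_of_nat_eq_real_of_nat power2_eq_square flip: ennreal_mult)
  finally show ?thesis .
qed

section \<open>Truncated samples\<close>

text \<open>Every sample has density \<open>indicator S\<close> divided by the mass Z of S. As Z is
  positive and finite, the factor Z^m clears the denominators, and S then enters the right side only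
  through indicators, ready for averaging.\<close>

lemma nn_integral_truncated_samples:
  assumes S [measurable]: "S \<in> sets (Rd d)" and pos: "0 < emeasure (gaussian d \<mu>) S"
    and h [measurable]: "h \<in> borel_measurable (samples d m)"
  shows "emeasure (gaussian d \<mu>) S ^ m * (\<integral>\<^sup>+x. h x \<partial>PiM {..<m} (\<lambda>_. truncated_gaussian d \<mu> S))
       = (\<integral>\<^sup>+x. (\<Prod>i<m. indicator S (x i)) * h x \<partial>PiM {..<m} (\<lambda>_. gaussian d \<mu>))"
proof -
  interpret G: prob_space "gaussian d \<mu>" by (rule prob_space_gaussian)
  let ?Z = "emeasure (gaussian d \<mu>) S"
  have Z: "?Z \<noteq> 0" "?Z \<noteq> \<top>" using pos by auto
  have ind [measurable]: "(\<lambda>x. indicator S (x i) :: ennreal) \<in> borel_measurable (samples d m)" if "i < m" for i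
  proof -
    have "(\<lambda>x. x i) \<in> measurable (samples d m) (Rd d)"
      by (rule measurable_component_singleton) (use that in simp)
    moreover have "(indicator S :: _ \<Rightarrow> ennreal) \<in> borel_measurable (Rd d)" by measurable
    ultimately show ?thesis by (rule measurable_compose)
  qed
  have prob: "prob_space (density (gaussian d \<mu>) (\<lambda>x. indicator S x / ?Z))"
    using prob_space_uniform_measure[of "gaussian d \<mu>" S] Z by (simp add: uniform_measure_def)
  have "PiM {..<m} (\<lambda>_. truncated_gaussian d \<mu> S)
      = density (PiM {..<m} (\<lambda>_. gaussian d \<mu>)) (\<lambda>x. \<Prod>i<m. indicator S (x i) / ?Z)"
    unfolding truncated_gaussian_def uniform_measure_def
    by (intro PiM_density prob_space_imp_sigma_finite[OF prob]
        prob_space_imp_sigma_finite[OF prob_space_gaussian]) auto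
  then have "(\<integral>\<^sup>+x. h x \<partial>PiM {..<m} (\<lambda>_. truncated_gaussian d \<mu> S))
      = (\<integral>\<^sup>+x. (\<Prod>i<m. indicator S (x i) / ?Z) * h x \<partial>PiM {..<m} (\<lambda>_. gaussian d \<mu>))"
    by (simp only:) (subst nn_integral_density, auto intro!: borel_measurable_prod_ennreal)
  then have "?Z ^ m * (\<integral>\<^sup>+x. h x \<partial>PiM {..<m} (\<lambda>_. truncated_gaussian d \<mu> S))
      = (\<integral>\<^sup>+x. ?Z ^ m * ((\<Prod>i<m. indicator S (x i) / ?Z) * h x) \<partial>PiM {..<m} (\<lambda>_. gaussian d \<mu>))"
    by (simp only:) (subst nn_integral_cmult, auto intro!: borel_measurable_prod_ennreal borel_measurable_times_ennreal)
  also have "\<dots> = (\<integral>\<^sup>+x. (\<Prod>i<m. indicator S (x i)) * h x \<partial>PiM {..<m} (\<lambda>_. gaussian d \<mu>))"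
  proof (intro nn_integral_cong)
    fix x
    have "?Z ^ m * (\<Prod>i<m. indicator S (x i) / ?Z) = (\<Prod>i<m. ?Z * (indicator S (x i) / ?Z))"
      by (simp add: prod.distrib)
    also have "\<dots> = (\<Prod>i<m. indicator S (x i))"
      using Z by (intro prod.cong refl)
        (simp add: ennreal_times_divide mult.commute ennreal_mult_divide_eq)
    finally show "?Z ^ m * ((\<Prod>i<m. indicator S (x i) / ?Z) * h x) = (\<Prod>i<m. indicator S (x i)) * h x"
      by (simp add: mult.assoc[symmetric])
  qed
  finally show ?thesis .
qed

lemma sets_truncated_gaussian: "sets (truncated_gaussian d \<mu> S) = sets (Rd d)"
  by (simp add: truncated_gaussian_def sets_gaussian)

lemma prob_space_truncated_gaussian:
  assumes "0 < emeasure (gaussian d \<mu>) S"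
  shows "prob_space (truncated_gaussian d \<mu> S)"
proof -
  interpret prob_space "gaussian d \<mu>" by (rule prob_space_gaussian)
  show ?thesis unfolding truncated_gaussian_def
    using assms by (intro prob_space_uniform_measure) auto
qed

text \<open>Conditioning on a set of mass at least q enlarges the mass of a cell by at most the
  factor 1/q.\<close>

lemma emeasure_truncated_cell_le:
  assumes d: "0 < d" and S: "S \<in> sets (Rd d)" and q: "0 < q" "ennreal q \<le> emeasure (gaussian d (mean d s)) S"
    and c: "c \<in> Pow {1..<d}"
  shows "emeasure (truncated_gaussian d (mean d s) S) {x \<in> space (Rd d). cell d x = c}
    \<le> ennreal ((1 / 2) ^ (d - 1) / q)"
proof -
  let ?G = "gaussian d (mean d s)" and ?C = "{x \<in> space (Rd d). cell d x = c}"
  have C: "?C \<in> sets (Rd d)" using c by measurable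
  have half: "(1 / 2 :: ennreal) = ennreal (1 / 2)" using divide_ennreal[of 1 2] by simp
  have "emeasure ?G (S \<inter> ?C) \<le> emeasure ?G ?C"
    using C by (intro emeasure_mono) (auto simp: sets_gaussian)
  also have "\<dots> = (1 / 2) ^ (d - 1)"
    using emeasure_gaussian_cell[OF d, of c UNIV s] c
      prob_space.emeasure_space_1[OF prob_space_normal, of "2 * s"]
    by (simp add: space_density)
  also have "\<dots> = ennreal ((1 / 2) ^ (d - 1))"
    unfolding half by (rule ennreal_power) simp
  finally have le: "emeasure ?G (S \<inter> ?C) \<le> ennreal ((1 / 2) ^ (d - 1))" .
  have "emeasure (truncated_gaussian d (mean d s) S) ?C = emeasure ?G (S \<inter> ?C) / emeasure ?G S"
    unfolding truncated_gaussian_def using S C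
    by (intro emeasure_uniform_measure) (auto simp: sets_gaussian)
  also have "\<dots> \<le> ennreal ((1 / 2) ^ (d - 1) / q)"
  proof (rule divide_le_posI_ennreal)
    show "0 < emeasure ?G S"
      by (rule less_le_trans[OF _ q(2)]) (use q(1) in simp)
    have "ennreal ((1 / 2) ^ (d - 1)) = ennreal ((1 / 2) ^ (d - 1) / q) * ennreal q"
      using q(1) by (simp flip: ennreal_mult)
    also have "\<dots> \<le> ennreal ((1 / 2) ^ (d - 1) / q) * emeasure ?G S"
      using q(2) by (rule mult_left_mono) simp
    finally show "emeasure ?G (S \<inter> ?C) \<le> emeasure ?G S * ennreal ((1 / 2) ^ (d - 1) / q)"
      using le by (simp add: mult.commute)
  qed
  finally show ?thesis .
qed

lemma emeasure_truncated_collision_le: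
  assumes d: "0 < d" and S: "S \<in> sets (Rd d)" and q: "0 < q" "ennreal q \<le> emeasure (gaussian d (mean d s)) S"
  shows "emeasure (PiM {..<m} (\<lambda>_. truncated_gaussian d (mean d s) S))
      (space (samples d m) - distinct_cells d m) \<le> ennreal (2 * real m ^ 2 / (q ^ 2 * 2 ^ d))"
proof -
  have "0 < emeasure (gaussian d (mean d s)) S"
    by (rule less_le_trans[OF _ q(2)]) (use q(1) in simp)
  then have "emeasure (PiM {..<m} (\<lambda>_. truncated_gaussian d (mean d s) S))
      (space (samples d m) - distinct_cells d m)
      \<le> ennreal (real m ^ 2 * (2 ^ (d - 1) * ((1 / 2) ^ (d - 1) / q) ^ 2))"
    using assms
    by (intro emeasure_collision_le prob_space_truncated_gaussian sets_truncated_gaussian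
        emeasure_truncated_cell_le) auto
  also have "real m ^ 2 * (2 ^ (d - 1) * ((1 / 2) ^ (d - 1) / q) ^ 2) = 2 * real m ^ 2 / (q ^ 2 * 2 ^ d)"
    using d by (cases d) (auto simp: power_divide power2_eq_square)
  finally show ?thesis .
qed

text \<open>On a collision the success probability is bounded by 1, so discarding collisions costs
  at most 39/100. The remaining 3/5 exceeds 1/2, which later makes success for both signs
  impossible.\<close>

lemma nn_integral_success_on_distinct:
  assumes K: "K \<in> algorithms d m" and pos: "0 < emeasure (gaussian d \<mu>) S"
    and B: "B \<in> sets (Rd d)"
    and succ: "measure (output_distribution d m K \<mu> S) B \<ge> 99 / 100"
    and coll: "emeasure (PiM {..<m} (\<lambda>_. truncated_gaussian d \<mu> S))
      (space (samples d m) - distinct_cells d m) \<le> ennreal (39 / 100)"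
  shows "ennreal (3 / 5) \<le> (\<integral>\<^sup>+x. emeasure (K x) B * indicator (distinct_cells d m) x
      \<partial>PiM {..<m} (\<lambda>_. truncated_gaussian d \<mu> S))"
    (is "_ \<le> ?I")
proof -
  let ?N = "PiM {..<m} (\<lambda>_. truncated_gaussian d \<mu> S)"
  have sets_N [measurable_cong]: "sets ?N = sets (samples d m)"
    by (intro sets_PiM_cong refl sets_truncated_gaussian)
  note space_N = sets_eq_imp_space_eq[OF sets_N]
  interpret N: prob_space ?N by (intro prob_space_PiM prob_space_truncated_gaussian pos)
  have K' [measurable]: "K \<in> measurable (samples d m) (subprob_algebra (Rd d))"
    using K unfolding algorithms_def by (rule measurable_prob_algebraD)
  have KB [measurable]: "(\<lambda>x. emeasure (K x) B) \<in> borel_measurable (samples d m)"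
    by (rule measurable_emeasure_kernel[OF K' B])
  have le_1: "emeasure (K x) B \<le> 1" if "x \<in> space (samples d m)" for x
    using measurable_space[OF K' that]
    by (auto simp: space_subprob_algebra intro: subprob_space.subprob_emeasure_le_1)
  have "ennreal (99 / 100) \<le> emeasure (output_distribution d m K \<mu> S) B"
    using succ ennreal_leI[OF succ]
    by (cases "emeasure (output_distribution d m K \<mu> S) B = \<top>") (auto simp: emeasure_eq_ennreal_measure)
  also have "\<dots> = (\<integral>\<^sup>+x. emeasure (K x) B \<partial>?N)"
    unfolding output_distribution_def using N.not_empty B by (intro emeasure_bind) auto
  \<comment> \<open>The kernel has mass at most 1, so the second indicator covers the collision
    part.\<close>
  also have "\<dots> \<le> (\<integral>\<^sup>+x. emeasure (K x) B * indicator (distinct_cells d m) x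
      + indicator (space (samples d m) - distinct_cells d m) x \<partial>?N)"
    using le_1 by (intro nn_integral_mono) (auto simp: indicator_def space_N)
  also have "\<dots> = ?I + (\<integral>\<^sup>+x. indicator (space (samples d m) - distinct_cells d m) x \<partial>?N)"
    by (intro nn_integral_add) measurable
  also have "(\<integral>\<^sup>+x. indicator (space (samples d m) - distinct_cells d m) x \<partial>?N)
      = emeasure ?N (space (samples d m) - distinct_cells d m)"
    by (intro nn_integral_indicator) measurable
  also have "?I + \<dots> \<le> ?I + ennreal (39 / 100)"
    by (intro add_left_mono coll)
  finally have "ennreal (99 / 100) \<le> ?I + ennreal (39 / 100)" .
  then show ?thesis
    by (cases ?I) (auto simp flip: ennreal_plus)
qed

text \<open>With fewer samples, success on distinct cells would have averaged weight at least (3/5)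
  F for each sign, where F is the averaged mass of distinct cells. The averaged measure is the same
  for both signs and the two success events are disjoint, so (6/5) F \<le> F, contradicting 0 < F
  \<le> 1.\<close>

lemma sample_lower_bound:
  assumes d: "0 < d" and K: "K \<in> algorithms d m" and q: "0 < q"
    and q_le: "\<And>s. s \<in> {1, - 1} \<Longrightarrow> ennreal q \<le> emeasure (normal (2 * s)) {x. s * x \<le> 0}"
    and est: "\<And>s \<theta>. s \<in> {1, - 1} \<Longrightarrow> measure (output_distribution d m K (mean d s) (step_set d s \<theta>))
      {y \<in> space (Rd d). eucl_dist d y (mean d s) \<le> 1} \<ge> 99 / 100"
  shows "real m \<ge> 2 / 5 * q * 2 powr (real d / 2)"
proof (rule ccontr)
  assume "\<not> real m \<ge> 2 / 5 * q * 2 powr (real d / 2)"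
  then have "real m ^ 2 \<le> (2 / 5 * q * 2 powr (real d / 2)) ^ 2"
    by (intro power_mono) auto
  also have "\<dots> = 4 / 25 * q ^ 2 * 2 ^ d"
    by (simp add: power_mult_distrib power2_eq_square powr_realpow flip: powr_add)
  finally have "real m ^ 2 \<le> 4 / 25 * (q ^ 2 * 2 ^ d)" by simp
  moreover have "0 < q ^ 2 * 2 ^ d" using q by simp
  \<comment> \<open>The factor 2/5 is chosen for this: 2 * (2/5)^2 = 32/100, below the allowed
    39/100.\<close>
  ultimately have small: "2 * real m ^ 2 / (q ^ 2 * 2 ^ d) \<le> 39 / 100"
    by (simp add: divide_le_eq)

  define B where "B s = {y \<in> space (Rd d). eucl_dist d y (mean d s) \<le> 1}" for s
  let ?D = "distinct_cells d m"
  \<comment> \<open>Success restricted to distinct cells, so that averaging over the thresholds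
    applies.\<close>
  define h where "h s x = emeasure (K x) (B s) * indicator ?D x" for s x
  let ?g = "\<lambda>x. ennreal (3 / 5) * indicator ?D x"
  let ?Z = "\<lambda>s \<theta>. emeasure (gaussian d (mean d s)) (step_set d s \<theta>)"
  let ?T = "\<lambda>s \<theta>. PiM {..<m} (\<lambda>_. truncated_gaussian d (mean d s) (step_set d s \<theta>))"
  let ?J = "\<lambda>s \<theta> f. \<integral>\<^sup>+x. (\<Prod>i<m. indicator (step_set d s \<theta>) (x i)) * f x
    \<partial>PiM {..<m} (\<lambda>_. gaussian d (mean d s))"
  let ?I = "\<lambda>s f. \<integral>\<^sup>+x. f x \<partial>PiM {..<m} (\<lambda>_. averaged d s)"
  interpret P: prob_space "prior d" by (rule prob_space_prior)
  have B [measurable]: "B s \<in> sets (Rd d)" for s unfolding B_def by measurable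
  have K' [measurable]: "K \<in> measurable (samples d m) (subprob_algebra (Rd d))"
    using K unfolding algorithms_def by (rule measurable_prob_algebraD)
  have KB [measurable]: "(\<lambda>x. emeasure (K x) (B s)) \<in> borel_measurable (samples d m)" for s
    by (rule measurable_emeasure_kernel[OF K' B])
  have h [measurable]: "h s \<in> borel_measurable (samples d m)" for s
    unfolding h_def by measurable
  have g: "?g \<in> borel_measurable (samples d m)"
    by (intro borel_measurable_times_ennreal borel_measurable_const borel_measurable_indicator
        distinct_cells_measurable)
  have qZ: "ennreal q \<le> ?Z s \<theta>" if "s \<in> {1, - 1}" for s \<theta>
    using q_le[OF that] emeasure_step_set_ge[OF d, where r = s and s = s and \<theta> = \<theta>] by (rule order_trans)
  have Z_pos: "0 < ?Z s \<theta>" if "s \<in> {1, - 1}" for s \<theta>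
    by (rule less_le_trans[OF _ qZ[OF that]]) (use q in simp)
  have Z_le: "?Z s \<theta> \<le> 1" for s \<theta>
    by (rule prob_space.emeasure_le_1[OF prob_space_gaussian])
  have J: "?J s \<theta> f = ?Z s \<theta> ^ m * (\<integral>\<^sup>+x. f x \<partial>?T s \<theta>)"
    if "s \<in> {1, - 1}" "f \<in> borel_measurable (samples d m)" for s \<theta> f
    using that by (intro nn_integral_truncated_samples[symmetric] step_set_measurable d Z_pos)
  have I: "(\<integral>\<^sup>+\<theta>. ?J s \<theta> f \<partial>prior d) = ?I s f"
    if "f \<in> borel_measurable (samples d m)" "\<And>x. x \<notin> ?D \<Longrightarrow> f x = 0" for s f
    using that by (intro nn_integral_prior_average d)
  have success: "ennreal (3 / 5) \<le> (\<integral>\<^sup>+x. h s x \<partial>?T s \<theta>)" if s: "s \<in> {1, - 1}" for s \<theta>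
    unfolding h_def
  proof (intro nn_integral_success_on_distinct K Z_pos B s)
    show "measure (output_distribution d m K (mean d s) (step_set d s \<theta>)) (B s) \<ge> 99 / 100"
      using est[OF s] by (simp add: B_def)
    show "emeasure (?T s \<theta>) (space (samples d m) - ?D) \<le> ennreal (39 / 100)"
      using emeasure_truncated_collision_le[OF d step_set_measurable[OF d] q qZ[OF s]]
        ennreal_leI[OF small] by (rule order_trans)
  qed
  have T_le_1: "(\<integral>\<^sup>+x. indicator ?D x \<partial>?T s \<theta>) \<le> 1" if "s \<in> {1, - 1}" for s \<theta>
  proof -
    interpret prob_space "?T s \<theta>"
      by (intro prob_space_PiM prob_space_truncated_gaussian Z_pos that)
    have "(\<integral>\<^sup>+x. indicator ?D x \<partial>?T s \<theta>) \<le> (\<integral>\<^sup>+x. 1 \<partial>?T s \<theta>)"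
      by (intro nn_integral_mono) (auto simp: indicator_def)
    then show ?thesis using emeasure_space_1 by simp
  qed
  define F where "F = ?I 1 (indicator ?D)"
  have I_ge: "ennreal (3 / 5) * F \<le> ?I s (h s)" and I_pos: "0 < ?I s (h s)"
    if s: "s \<in> {1, - 1}" for s
  proof -
    have "F = ?I s (indicator ?D)" using s averaged_eq[OF d] by (auto simp: F_def)
    moreover have "sets (PiM {..<m} (\<lambda>_. averaged d s)) = sets (samples d m)"
      by (intro sets_PiM_cong) (auto simp: averaged_def sets_gaussian)
    ultimately have "ennreal (3 / 5) * F = ?I s ?g"
      using distinct_cells_measurable[of d m] by (simp add: nn_integral_cmult_indicator)
    also have "\<dots> = (\<integral>\<^sup>+\<theta>. ?J s \<theta> ?g \<partial>prior d)"
      by (rule I[symmetric]) (auto simp: g)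
    \<comment> \<open>The comparison is made for each fixed \<theta>, where both sides carry the
      same factor Z^m; its dependence on \<theta> is therefore harmless.\<close>
    also have "\<dots> \<le> (\<integral>\<^sup>+\<theta>. ?J s \<theta> (h s) \<partial>prior d)"
    proof (rule nn_integral_mono)
      fix \<theta>
      have sets_T: "sets (?T s \<theta>) = sets (samples d m)"
        by (intro sets_PiM_cong refl sets_truncated_gaussian)
      have "(\<integral>\<^sup>+x. ?g x \<partial>?T s \<theta>) = ennreal (3 / 5) * (\<integral>\<^sup>+x. indicator ?D x \<partial>?T s \<theta>)"
        using distinct_cells_measurable[of d m] sets_T by (simp add: nn_integral_cmult_indicator)
      also have "\<dots> \<le> ennreal (3 / 5) * 1"
        by (intro mult_left_mono T_le_1 s) simp
      also have "\<dots> \<le> (\<integral>\<^sup>+x. h s x \<partial>?T s \<theta>)" using success[OF s] by simp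
      finally have "?Z s \<theta> ^ m * (\<integral>\<^sup>+x. ?g x \<partial>?T s \<theta>) \<le> ?Z s \<theta> ^ m * (\<integral>\<^sup>+x. h s x \<partial>?T s \<theta>)"
        by (intro mult_left_mono) simp_all
      moreover have "?J s \<theta> ?g = ?Z s \<theta> ^ m * (\<integral>\<^sup>+x. ?g x \<partial>?T s \<theta>)"
        by (rule J[OF s g])
      ultimately show "?J s \<theta> ?g \<le> ?J s \<theta> (h s)" using J[OF s h] by simp
    qed
    also have I_h: "\<dots> = ?I s (h s)" by (rule I) (auto simp: h_def[abs_def])
    finally show "ennreal (3 / 5) * F \<le> ?I s (h s)" .
    \<comment> \<open>The uniform bound Z \<ge> q keeps the average away from 0; this will give F >
      0.\<close>
    have "0 < ennreal q ^ m * ennreal (3 / 5)"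
      using q by (simp add: ennreal_zero_less_mult_iff ennreal_power)
    also have "\<dots> = (\<integral>\<^sup>+\<theta>. ennreal q ^ m * ennreal (3 / 5) \<partial>prior d)"
      using P.emeasure_space_1 by simp
    also have "\<dots> \<le> (\<integral>\<^sup>+\<theta>. ?J s \<theta> (h s) \<partial>prior d)"
      unfolding J[OF s h] using qZ[OF s] success[OF s]
      by (intro nn_integral_mono mult_mono power_mono) auto
    finally show "0 < ?I s (h s)" unfolding I_h .
  qed
  have "F = (\<integral>\<^sup>+\<theta>. ?J 1 \<theta> (indicator ?D) \<partial>prior d)"
    unfolding F_def by (rule I[symmetric]) auto
  also have "\<dots> \<le> (\<integral>\<^sup>+\<theta>. 1 \<partial>prior d)"
  proof (rule nn_integral_mono)
    fix \<theta>
    have "?J 1 \<theta> (indicator ?D) = ?Z 1 \<theta> ^ m * (\<integral>\<^sup>+x. indicator ?D x \<partial>?T 1 \<theta>)"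
      by (rule J) auto
    also have "\<dots> \<le> 1 ^ m * 1"
      by (intro mult_mono power_mono Z_le T_le_1) auto
    finally show "?J 1 \<theta> (indicator ?D) \<le> 1" by simp
  qed
  also have "\<dots> = 1" using P.emeasure_space_1 by simp
  finally have F_le: "F \<le> 1" .
  have "?I 1 (h 1) + ?I (- 1) (h (- 1)) = ?I 1 (\<lambda>x. h 1 x + h (- 1) x)"
  proof -
    have "sets (PiM {..<m} (\<lambda>_. averaged d 1)) = sets (samples d m)"
      by (intro sets_PiM_cong) (auto simp: averaged_def sets_gaussian)
    note [measurable_cong] = this
    show ?thesis unfolding averaged_eq[OF d, symmetric]
      by (intro nn_integral_add[symmetric]) measurable
  qed
  also have "\<dots> \<le> F"
    unfolding F_def
  proof (rule nn_integral_mono)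
    fix x
    show "h 1 x + h (- 1) x \<le> indicator ?D x"
    proof (cases "x \<in> ?D")
      case True
      then have "x \<in> space (samples d m)" by (simp add: distinct_cells_def)
      from measurable_space[OF K' this]
      have sub: "subprob_space (K x)" and sets: "sets (K x) = sets (Rd d)"
        by (auto simp: space_subprob_algebra)
      \<comment> \<open>The means are at distance 4 along coordinate 0, so the unit balls around
        them cannot meet.\<close>
      have "B 1 \<inter> B (- 1) = {}"
      proof (rule equals0I)
        fix y assume "y \<in> B 1 \<inter> B (- 1)"
        then have "eucl_dist d y (mean d 1) \<le> 1" "eucl_dist d y (mean d (- 1)) \<le> 1"
          by (auto simp: B_def)
        then have "\<bar>y 0 - 2\<bar> \<le> 1" "\<bar>y 0 + 2\<bar> \<le> 1"
          using abs_diff_le_eucl_dist[OF d, of y "mean d 1"]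
            abs_diff_le_eucl_dist[OF d, of y "mean d (- 1)"] d by (auto simp: mean_def)
        then show False by linarith
      qed
      then have "emeasure (K x) (B 1) + emeasure (K x) (B (- 1)) = emeasure (K x) (B 1 \<union> B (- 1))"
        using B sets by (intro plus_emeasure) auto
      also have "\<dots> \<le> 1" by (rule subprob_space.subprob_emeasure_le_1[OF sub])
      finally show ?thesis using True by (simp add: h_def)
    qed (simp add: h_def)
  qed
  finally have le_F: "?I 1 (h 1) + ?I (- 1) (h (- 1)) \<le> F" .
  have "0 < ?I 1 (h 1) + ?I (- 1) (h (- 1))"
    using I_pos[of 1] by (simp add: add_pos_nonneg)
  then have F_pos: "0 < F" using le_F by (rule less_le_trans)
  have "ennreal (3 / 5) * F + ennreal (3 / 5) * F \<le> ?I 1 (h 1) + ?I (- 1) (h (- 1))"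
    by (intro add_mono I_ge) auto
  then have "ennreal (3 / 5) * F + ennreal (3 / 5) * F \<le> F" using le_F by (rule order_trans)
  \<comment> \<open>Finiteness of F excludes the value \<infinity>, for which the inequality would
    hold.\<close>
  with F_pos F_le show False
    by (cases F) (auto simp: top_unique simp flip: ennreal_mult ennreal_plus)
qed

theorem theorem7:
  "\<exists>C>0. \<exists>c>0. \<forall>d::nat. d \<ge> 1 \<longrightarrow>
     (\<exists>\<S>. \<S> \<subseteq> truncation_sets d \<and>
          family_surface_area d \<S> \<le> ennreal (C * real d) \<and>
          (\<forall>m. \<forall>K\<in>algorithms d m. estimates_mean d \<S> m K \<longrightarrow>
             real m \<ge> c * 2 powr (real d / 2)))"
proof -
  let ?p = "\<lambda>s. measure (normal (2 * s)) {x. s * x \<le> 0}"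
  \<comment> \<open>Both masses are one-dimensional, so q depends on neither d nor m and the
    constants are absolute. The masses agree by reflection; the minimum saves proving it.\<close>
  define q where "q = min (?p 1) (?p (- 1))"
  have p: "emeasure (normal (2 * s)) {x. s * x \<le> 0} = ennreal (?p s)" for s
    by (intro finite_measure.emeasure_eq_measure prob_space.finite_measure prob_space_normal)
  have q: "0 < q"
    using normal_pos[of 1 2] normal_pos[of "- 1" "- 2"] p[of 1] p[of "- 1"]
    by (simp add: q_def)
  have q_le: "ennreal q \<le> emeasure (normal (2 * s)) {x. s * x \<le> 0}" if "s \<in> {1, - 1}" for s
    using that unfolding p by (intro ennreal_leI) (auto simp: q_def)
  show ?thesis
  proof (rule exI[of _ 2], rule conjI, simp, rule exI[of _ "2 / 5 * q"], rule conjI,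
      use q in simp, intro allI impI)
    fix d :: nat assume "1 \<le> d"
    then have d: "0 < d" by simp
    let ?S = "{step_set d s \<theta> | s \<theta>. s \<in> {1, - 1}}"
    show "\<exists>\<S>. \<S> \<subseteq> truncation_sets d \<and> family_surface_area d \<S> \<le> ennreal (2 * real d) \<and>
        (\<forall>m. \<forall>K\<in>algorithms d m. estimates_mean d \<S> m K \<longrightarrow> real m \<ge> 2 / 5 * q * 2 powr (real d / 2))"
    proof (intro exI[of _ ?S] conjI allI ballI impI)
      show "?S \<subseteq> truncation_sets d" using step_set_truncation_set[OF d] by auto
      show "family_surface_area d ?S \<le> ennreal (2 * real d)"
        unfolding family_surface_area_def using surface_area_step_set_le[OF d]
        by (intro SUP_least) auto
      fix m K assume K: "K \<in> algorithms d m" and est: "estimates_mean d ?S m K"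
      show "real m \<ge> 2 / 5 * q * 2 powr (real d / 2)"
        using est mean_in_space
        by (intro sample_lower_bound[OF d K q q_le]) (auto simp: estimates_mean_def)
    qed
  qed
qed

end
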